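(* Let $\mathcal H$ be a real Hilbert space and let $F:\mathcal H\to\mathcal H$ be a monotone, $L$-Lipschitz operator with $L>0$ and with a zero $x^*\in\mathcal H$, i.e. $F(x^* )=0$. Let $x_0\in\mathcal H$ and let $R:=\|x_0-x^*\|$. For $k\ge 0$ let $\delta_k=\frac{4}{k+4}$ and let $\eta_k>0$ satisfy $2\eta_kL=\sqrt{\delta_k}$. Consider the iteration started at $x_0$, $$x_{k+1}=x_k-\eta_kF(x_k)-\delta_k(x_k-x_0),\qquad k\ge 0.$$ Then, for every $k\ge1$, $$\|F(x_k)\|\le\frac{24LR}{\sqrt{k+3}}.$$
   Context: An operator $F:\mathcal H\to\mathcal H$ on a real Hilbert space is monotone if $\langle F(x)-F(y),x-y\rangle\ge0$ for all $x,y\in\mathcal H$, and $L$-Lipschitz if $\|F(x)-F(y)\|\le L\|x-y\|$ for all $x,y\in\mathcal H$. *)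

theory Defs
  imports "HOL-Analysis.Analysis"
begin

definition monotone_operator :: "('a::real_inner \<Rightarrow> 'a) \<Rightarrow> bool" where
  "monotone_operator F \<longleftrightarrow> (\<forall>x y. inner (F x - F y) (x - y) \<ge> 0)"

end

theory Submission
  imports Defs
begin

text \<open>
  With \<open>\<rho> = \<eta>\<^sub>k / \<eta>\<^sub>k\<^sub>-\<^sub>1\<close>, eliminating \<open>F (x\<^sub>k\<^sub>-\<^sub>1)\<close> shows that the increments
  \<open>v\<^sub>k = x\<^sub>k\<^sub>+\<^sub>1 - x\<^sub>k\<close> satisfy
  \<open>v\<^sub>k = (\<rho> - \<delta>\<^sub>k) v\<^sub>k\<^sub>-\<^sub>1 - \<eta>\<^sub>k (F (x\<^sub>k) - F (x\<^sub>k\<^sub>-\<^sub>1)) + (\<rho> \<delta>\<^sub>k\<^sub>-\<^sub>1 - \<delta>\<^sub>k) (x\<^sub>k\<^sub>-\<^sub>1 - x\<^sub>0)\<close>.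
  Monotonicity and the Lipschitz bound make the first two terms a contraction of \<open>v\<^sub>k\<^sub>-\<^sub>1\<close> by the
  factor \<open>1 - 3 / (2 (k + 4))\<close>, and the last term is \<open>O(R / k\<^sup>2)\<close>, since the same contraction
  argument keeps \<open>x\<^sub>k\<close> within \<open>2 R\<close> of the zero. So \<open>v\<^sub>k\<close> has norm at most \<open>12 R / (k + 4)\<close>,
  and \<open>\<eta>\<^sub>k F (x\<^sub>k) = - v\<^sub>k - \<delta>\<^sub>k (x\<^sub>k - x\<^sub>0)\<close> gives the rate.
\<close>

lemma monotone_lipschitz_step_le:
  fixes F :: "'a::real_inner \<Rightarrow> 'a"
  assumes mono: "monotone_operator F" and lip: "L-lipschitz_on UNIV F"
    and "0 \<le> c" "0 \<le> e" "0 \<le> q" and q: "c\<^sup>2 + (e * L)\<^sup>2 \<le> q\<^sup>2"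
  shows "norm (c *\<^sub>R (x - y) - e *\<^sub>R (F x - F y)) \<le> q * norm (x - y)"
proof -
  define u w where "u = x - y" and "w = F x - F y"
  have "inner u w \<ge> 0"
    using mono by (simp add: monotone_operator_def u_def w_def inner_commute)
  then have cross: "0 \<le> c * e * inner u w"
    using \<open>0 \<le> c\<close> \<open>0 \<le> e\<close> by simp
  have "norm w \<le> L * norm u"
    using lipschitz_onD[OF lip, of x y] by (simp add: u_def w_def dist_norm)
  then have "e * norm w \<le> e * L * norm u"
    using \<open>0 \<le> e\<close> by (simp add: mult_left_mono mult.assoc)
  then have w: "(e * norm w)\<^sup>2 \<le> (e * L)\<^sup>2 * (norm u)\<^sup>2"
    using \<open>0 \<le> e\<close> by (metis mult_nonneg_nonneg norm_ge_zero power_mono power_mult_distrib)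
  have "(norm (c *\<^sub>R u - e *\<^sub>R w))\<^sup>2 = c\<^sup>2 * (norm u)\<^sup>2 - 2 * (c * e * inner u w) + (e * norm w)\<^sup>2"
    by (simp only: power_mult_distrib power2_norm_eq_inner)
      (simp add: inner_diff_left inner_diff_right inner_commute power2_eq_square algebra_simps)
  also have "\<dots> \<le> (c\<^sup>2 + (e * L)\<^sup>2) * (norm u)\<^sup>2"
    using w cross by (simp add: algebra_simps)
  also have "\<dots> \<le> (q * norm u)\<^sup>2"
    using mult_right_mono[OF q, of "(norm u)\<^sup>2"] by (simp add: power_mult_distrib)
  finally show ?thesis
    unfolding u_def w_def using \<open>0 \<le> q\<close> by (meson mult_nonneg_nonneg norm_ge_zero power2_le_imp_le)
qed

text \<open>The radius \<open>2 * norm (x0 - z)\<close> is the fixed point of \<open>r \<mapsto> (1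
  - \<delta> k / 2) * r + \<delta> k * norm (x0 - z)\<close>, whatever the positive value of
  \<open>\<delta> k\<close>, so the ball is preserved by each step.\<close>

lemma anchored_iterate_dist_le:
  fixes F :: "'a::real_inner \<Rightarrow> 'a"
  assumes "monotone_operator F" and "L-lipschitz_on UNIV F" and "F z = 0"
    and \<delta>: "\<And>k. 0 \<le> \<delta> k" "\<And>k. \<delta> k \<le> 1"
    and \<eta>: "\<And>k. 0 \<le> \<eta> k" "\<And>k. (\<eta> k * L)\<^sup>2 = \<delta> k / 4"
    and "x 0 = x0"
    and step: "\<And>k. x (Suc k) = x k - \<eta> k *\<^sub>R F (x k) - \<delta> k *\<^sub>R (x k - x0)"
  shows "norm (x k - z) \<le> 2 * norm (x0 - z)"
proof (induction k)
  case 0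
  show ?case using \<open>x 0 = x0\<close> by simp
next
  case (Suc k)
  \<comment> \<open>After expansion, the squared contraction condition reduces to exactly this
    inequality.\<close>
  have "\<delta> k * \<delta> k \<le> \<delta> k"
    using mult_left_mono[OF \<delta>(2)[of k] \<delta>(1)[of k]] by simp
  then have "(1 - \<delta> k)\<^sup>2 + (\<eta> k * L)\<^sup>2 \<le> (1 - \<delta> k / 2)\<^sup>2"
    unfolding \<eta> by (simp add: power2_eq_square field_simps)
  then have contr: "norm ((1 - \<delta> k) *\<^sub>R (x k - z) - \<eta> k *\<^sub>R (F (x k) - F z))
      \<le> (1 - \<delta> k / 2) * norm (x k - z)"
    using \<delta>(1)[of k] \<delta>(2)[of k] \<eta>(1) by (intro monotone_lipschitz_step_le[OF assms(1,2)]) auto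
  have "x (Suc k) - z
      = ((1 - \<delta> k) *\<^sub>R (x k - z) - \<eta> k *\<^sub>R (F (x k) - F z)) + \<delta> k *\<^sub>R (x0 - z)"
    unfolding step \<open>F z = 0\<close> by (simp add: algebra_simps)
  then have "norm (x (Suc k) - z) \<le> (1 - \<delta> k / 2) * norm (x k - z) + \<delta> k * norm (x0 - z)"
    using contr \<delta>(1)[of k] norm_triangle_mono by fastforce
  also have "\<dots> \<le> (1 - \<delta> k / 2) * (2 * norm (x0 - z)) + \<delta> k * norm (x0 - z)"
    using \<delta>(2)[of k] by (intro add_right_mono mult_left_mono Suc.IH) auto
  finally show ?case by (simp add: algebra_simps)
qed

text \<open>Increments meet a difference of values of \<open>F\<close>, to which monotonicity
  applies, and the anchor term keeps only a difference of nearly equal coefficients.\<close>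

lemma anchored_increment_recurrence:
  fixes x :: "nat \<Rightarrow> 'a::real_vector"
  assumes step: "\<And>k. x (Suc k) = x k - \<eta> k *\<^sub>R F (x k) - \<delta> k *\<^sub>R (x k - x0)"
    and "\<eta> k \<noteq> 0" and \<rho>: "\<rho> = \<eta> (Suc k) / \<eta> k"
  shows "x (Suc (Suc k)) - x (Suc k)
    = ((\<rho> - \<delta> (Suc k)) *\<^sub>R (x (Suc k) - x k) - \<eta> (Suc k) *\<^sub>R (F (x (Suc k)) - F (x k)))
      + (\<rho> * \<delta> k - \<delta> (Suc k)) *\<^sub>R (x k - x0)"
proof -
  have "\<eta> (Suc k) *\<^sub>R F (x k) = \<rho> *\<^sub>R (\<eta> k *\<^sub>R F (x k))"
    using \<open>\<eta> k \<noteq> 0\<close> by (simp add: \<rho>)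
  also have "\<eta> k *\<^sub>R F (x k) = - (x (Suc k) - x k) - \<delta> k *\<^sub>R (x k - x0)"
    by (simp add: step[of k])
  finally have F: "\<eta> (Suc k) *\<^sub>R F (x k) = \<rho> *\<^sub>R (- (x (Suc k) - x k) - \<delta> k *\<^sub>R (x k - x0))" .
  show ?thesis
    unfolding step[of "Suc k"] scaleR_diff_right[of "\<eta> (Suc k)"] F
    by (simp add: algebra_simps)
qed

text \<open>Here \<open>n\<close> stands for \<open>k + 5\<close>, so that \<open>4 / n\<close>,
  \<open>4 / (n - 1)\<close> and \<open>1 / n\<close> are \<open>\<delta> (Suc k)\<close>,
  \<open>\<delta> k\<close> and \<open>(\<eta> (Suc k) * L)\<^sup>2\<close>. Everything follows from
  \<open>1 - t \<le> \<rho> \<le> 1 - t / 2\<close> with \<open>t = 1 / n\<close>.\<close>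

lemma step_ratio_bounds:
  fixes n \<rho> :: real
  assumes "n \<ge> 5" and "\<rho> \<ge> 0" and sq: "\<rho>\<^sup>2 = 1 - 1 / n"
  shows "4 / n \<le> \<rho>"
    and "(\<rho> - 4 / n)\<^sup>2 + 1 / n \<le> (1 - 3 / (2 * n))\<^sup>2"
    and "\<bar>\<rho> * (4 / (n - 1)) - 4 / n\<bar> \<le> 2 / (n * (n - 1))"
proof -
  define t where "t = 1 / n"
  have t: "0 < t" "t \<le> 1 / 5"
    using \<open>n \<ge> 5\<close> by (simp_all add: t_def field_simps)
  have "1 - t \<le> \<rho>"
  proof (rule power2_le_imp_le)
    have "(1 - t)\<^sup>2 \<le> (1 - t) * 1"
      unfolding power2_eq_square using t by (intro mult_left_mono) auto
    then show "(1 - t)\<^sup>2 \<le> \<rho>\<^sup>2" using sq by (simp add: t_def)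
  qed fact
  have "\<rho> \<le> 1 - t / 2"
  proof (rule power2_le_imp_le)
    have "(1 - t / 2)\<^sup>2 = 1 - t + (t / 2)\<^sup>2" by (simp add: power2_eq_square algebra_simps)
    then show "\<rho>\<^sup>2 \<le> (1 - t / 2)\<^sup>2" using sq by (simp add: t_def)
  qed (use t in simp)
  show "4 / n \<le> \<rho>"
    using \<open>1 - t \<le> \<rho>\<close> t unfolding t_def by linarith
  \<comment> \<open>With \<rho> replaced by \<open>1 - t\<close>, the claim becomes
    \<open>87 / 4 * t\<^sup>2 \<le> 5 * t\<close>, which \<open>t \<le> 1 / 5\<close>
    ensures.\<close>
  have "t - t * t \<le> t * \<rho>"
    using mult_left_mono[OF \<open>1 - t \<le> \<rho>\<close>, of t] t by (simp add: algebra_simps)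
  moreover have "t * t \<le> t * (1 / 5)"
    using t by (intro mult_left_mono) auto
  moreover have "(\<rho> - 4 * t)\<^sup>2 + t = 1 - 8 * (t * \<rho>) + 16 * (t * t)"
    using sq by (simp add: power2_eq_square t_def algebra_simps)
  moreover have "(1 - 3 / 2 * t)\<^sup>2 = 1 - 3 * t + 9 / 4 * (t * t)"
    by (simp add: power2_eq_square algebra_simps)
  ultimately have "(\<rho> - 4 * t)\<^sup>2 + t \<le> (1 - 3 / 2 * t)\<^sup>2"
    using t by linarith
  then show "(\<rho> - 4 / n)\<^sup>2 + 1 / n \<le> (1 - 3 / (2 * n))\<^sup>2"
    by (simp add: t_def)
  have eq: "\<rho> * (4 / (n - 1)) - 4 / n = 4 * (n * \<rho> - (n - 1)) / (n * (n - 1))"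
    using \<open>n \<ge> 5\<close> by (simp add: field_simps)
  have "n * (1 - t) \<le> n * \<rho>" "n * \<rho> \<le> n * (1 - t / 2)"
    using \<open>1 - t \<le> \<rho>\<close> \<open>\<rho> \<le> 1 - t / 2\<close> \<open>n \<ge> 5\<close> by (auto intro: mult_left_mono)
  then have "\<bar>4 * (n * \<rho> - (n - 1))\<bar> \<le> 2"
    using \<open>n \<ge> 5\<close> by (simp add: t_def right_diff_distrib)
  then show "\<bar>\<rho> * (4 / (n - 1)) - 4 / n\<bar> \<le> 2 / (n * (n - 1))"
    unfolding eq using \<open>n \<ge> 5\<close> by (simp add: abs_mult abs_divide divide_right_mono)
qed

theorem theorem1:
  fixes F :: "'a::{real_inner, complete_space} \<Rightarrow> 'a"
    and L R :: real
    and xstar x0 :: 'a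
    and x :: "nat \<Rightarrow> 'a"
    and \<delta> \<eta> :: "nat \<Rightarrow> real"
  assumes "monotone_operator F"
    and "L-lipschitz_on UNIV F"
    and "L > 0"
    and "F xstar = 0"
    and "R = norm (x0 - xstar)"
    and "\<And>k. \<delta> k = 4 / (real k + 4)"
    and "\<And>k. \<eta> k > 0"
    and "\<And>k. 2 * \<eta> k * L = sqrt (\<delta> k)"
    and "x 0 = x0"
    and "\<And>k. x (Suc k) = x k - \<eta> k *\<^sub>R F (x k) - \<delta> k *\<^sub>R (x k - x0)"
  shows "\<forall>k\<ge>1. norm (F (x k)) \<le> 24 * L * R / sqrt (real k + 3)"
proof (intro allI impI)
  note mono = assms(1) and lip = assms(2) and \<delta> = assms(6) and \<eta>pos = assms(7) and step = assms(10)
  have "R \<ge> 0" using assms(5) by simp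
  have \<delta>01: "0 \<le> \<delta> k" "\<delta> k \<le> 1" for k by (simp_all add: \<delta>)
  have \<eta>L: "\<eta> k * L = 1 / sqrt (real k + 4)" for k
    using assms(8)[of k] by (simp add: \<delta> real_sqrt_divide)
  have \<eta>sq: "(\<eta> k * L)\<^sup>2 = 1 / (real k + 4)" for k
    by (simp add: \<eta>L power_divide)
  have "(\<eta> k * L)\<^sup>2 = \<delta> k / 4" for k
    unfolding \<eta>sq \<delta> by (simp add: field_simps)
  then have "norm (x k - xstar) \<le> 2 * R" for k
    unfolding assms(5) using \<delta>01 \<eta>pos[THEN less_imp_le]
    by (intro anchored_iterate_dist_le[OF mono lip assms(4) _ _ _ _ assms(9) step])
  then have dist: "norm (x k - x0) \<le> 3 * R" for k
    using norm_triangle_ineq4[of "x k - xstar" "x0 - xstar"] assms(5)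
    by (smt (verit) diff_diff_eq2 diff_add_cancel)
  \<comment> \<open>A constant \<open>C\<close> survives the induction when
    \<open>C * (n - 3 / 2) + 6 \<le> C * (n - 1)\<close>; \<open>C = 12\<close> gives equality. The
    factor \<open>3 / 2\<close> exceeds 1, which leaves room for the drift.\<close>
  have incr: "norm (x (Suc k) - x k) \<le> 12 * R / (real k + 4)" for k
  proof (induction k)
    case 0
    have "norm (x (Suc 0) - x 0) = \<eta> 0 * norm (F x0 - F xstar)"
      using step[of 0] assms(4,9) \<eta>pos[of 0] by simp
    also have "\<dots> \<le> \<eta> 0 * (L * R)"
      using lipschitz_onD[OF lip, of x0 xstar] \<eta>pos[of 0] assms(5)
      by (intro mult_left_mono) (auto simp: dist_norm)
    also have "\<dots> = R / 2"
      using \<eta>L[of 0] by (simp add: mult.assoc[symmetric])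
    finally show ?case using \<open>R \<ge> 0\<close> by simp
  next
    case (Suc k)
    define n where "n = real k + 5"
    define \<rho> where "\<rho> = \<eta> (Suc k) / \<eta> k"
    have n: "n \<ge> 5" "real (Suc k) + 4 = n" "real k + 4 = n - 1" by (simp_all add: n_def)
    have "\<rho> \<ge> 0" using \<eta>pos[of k] \<eta>pos[of "Suc k"] by (simp add: \<rho>_def)
    \<comment> \<open>Inserting \<open>L\<close> makes the squared ratio the explicit
      \<open>(k + 4) / (k + 5)\<close>.\<close>
    have "\<rho> = (\<eta> (Suc k) * L) / (\<eta> k * L)" using \<open>L > 0\<close> by (simp add: \<rho>_def)
    then have "\<rho>\<^sup>2 = 1 - 1 / n"
      using n by (simp only: power_divide \<eta>sq) (simp add: field_simps)
    note \<rho> = step_ratio_bounds[OF n(1) \<open>\<rho> \<ge> 0\<close> this]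
    have \<delta>': "\<delta> (Suc k) = 4 / n" "\<delta> k = 4 / (n - 1)"
      by (simp_all only: \<delta> n)
    have contr: "norm ((\<rho> - \<delta> (Suc k)) *\<^sub>R (x (Suc k) - x k) - \<eta> (Suc k) *\<^sub>R (F (x (Suc k)) - F (x k)))
        \<le> (1 - 3 / (2 * n)) * norm (x (Suc k) - x k)"
    proof (intro monotone_lipschitz_step_le[OF mono lip])
      show "(\<rho> - \<delta> (Suc k))\<^sup>2 + (\<eta> (Suc k) * L)\<^sup>2 \<le> (1 - 3 / (2 * n))\<^sup>2"
        using \<rho>(2) by (simp only: \<delta>' \<eta>sq n)
    qed (use \<rho>(1) n(1) \<eta>pos[of "Suc k"] in \<open>auto simp: \<delta>' field_simps\<close>)
    have drift: "norm ((\<rho> * \<delta> k - \<delta> (Suc k)) *\<^sub>R (x k - x0)) \<le> 2 / (n * (n - 1)) * (3 * R)"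
      unfolding norm_scaleR \<delta>' using n(1) by (intro mult_mono \<rho>(3) dist) auto
    have "norm (x (Suc (Suc k)) - x (Suc k))
        \<le> (1 - 3 / (2 * n)) * norm (x (Suc k) - x k) + 2 / (n * (n - 1)) * (3 * R)"
      using \<eta>pos[of k] anchored_increment_recurrence[of x \<eta> F \<delta> x0 k, OF step _ \<rho>_def]
        norm_triangle_mono[OF contr drift] by simp
    also have "\<dots> \<le> (1 - 3 / (2 * n)) * (12 * R / (n - 1)) + 2 / (n * (n - 1)) * (3 * R)"
      using Suc.IH n by (intro add_right_mono mult_left_mono) (auto simp: field_simps)
    also have "\<dots> = 12 * R / n"
      using n(1) by (simp add: divide_simps) (simp add: algebra_simps)
    finally show ?case by (simp only: n)
  qed
  fix k :: nat
  assume "k \<ge> 1"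
  define s where "s = sqrt (real k + 4)"
  have s: "s > 0" "s\<^sup>2 = real k + 4" by (simp_all add: s_def)
  have "\<eta> k *\<^sub>R F (x k) = - (x (Suc k) - x k) - \<delta> k *\<^sub>R (x k - x0)"
    by (simp add: step)
  then have "\<eta> k * norm (F (x k)) = norm (- (x (Suc k) - x k) - \<delta> k *\<^sub>R (x k - x0))"
    using \<eta>pos[of k] by (metis abs_of_pos norm_scaleR)
  also have "\<dots> \<le> norm (x (Suc k) - x k) + \<delta> k * norm (x k - x0)"
    using norm_triangle_ineq4[of "- (x (Suc k) - x k)" "\<delta> k *\<^sub>R (x k - x0)"] \<delta>01(1)[of k]
    by (simp add: norm_minus_commute)
  also have "\<dots> \<le> 12 * R / (real k + 4) + \<delta> k * (3 * R)"
    by (intro add_mono incr mult_left_mono dist \<delta>01)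
  \<comment> \<open>The constant is 12 from the increment plus 4 * 3 from the anchor. Since
    \<open>\<eta> k * L = 1 / s\<close>, isolating the operator value costs one factor
    \<open>s\<close>.\<close>
  also have "\<dots> = 24 * R / s\<^sup>2"
    unfolding s(2) by (simp add: \<delta> add_divide_distrib[symmetric])
  finally have "L * (\<eta> k * norm (F (x k))) \<le> L * (24 * R / s\<^sup>2)"
    using \<open>L > 0\<close> by (intro mult_left_mono) auto
  moreover have "L * (\<eta> k * norm (F (x k))) = norm (F (x k)) / s"
    using \<eta>L[of k] by (simp add: s_def mult.commute mult.left_commute mult.assoc[symmetric])
  ultimately have "norm (F (x k)) \<le> 24 * L * R / s"
    using s(1) by (simp add: field_simps power2_eq_square)
  also have "\<dots> \<le> 24 * L * R / sqrt (real k + 3)"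
    using \<open>L > 0\<close> \<open>R \<ge> 0\<close> by (intro divide_left_mono) (auto simp: s_def)
  finally show "norm (F (x k)) \<le> 24 * L * R / sqrt (real k + 3)" .
qed

end
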